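(* Let $\lambda$ be a nonzero real number, let $Y_1,Y_2,\dots$ be independent random variables each uniformly distributed on $[0,1]$, and let $Y^{(k)}=Y_1+\cdots+Y_k$ for $k\ge1$, $Y^{(0)}=0$. Let $m,l$ be integers with $m\ge l\ge0$. Then for all integers $n\ge0$, \[ \sum_{k=0}^{n}\frac{\binom{n}{k}}{\binom{n-k+m}{m}}\lambda^{n-k}S_{1}(n-k+m,m)\,E\Big[\beta_{k,\lambda}^{(m)}\big(x+Y^{(l)}\big)\Big] =\sum_{k=0}^{n}\frac{\binom{n}{k}}{\binom{n-k+m-l}{m-l}}\lambda^{n-k}S_{1}(n-k+m-l,m-l)\,\beta_{k,\lambda}^{(m-l)}(x). \]
   Context: For a nonzero real $\lambda$ and any $x$, set $(x)_{0,\lambda}=1$ and $(x)_{n,\lambda}=x(x-\lambda)\cdots(x-(n-1)\lambda)$ for $n\ge1$, $e_{\lambda}^{x}(t)=\sum_{k\ge0}(x)_{k,\lambda}\frac{t^k}{k!}=(1+\lambda t)^{x/\lambda}$, $e_\lambda(t)=e_\lambda^1(t)$. For an integer $m\ge0$, the higher-order degenerate Bernoulli polynomials are defined by $\left(\frac{t}{e_\lambda(t)-1}\right)^{m}e_\lambda^x(t)=\sum_{n\ge0}\beta_{n,\lambda}^{(m)}(x)\frac{t^n}{n!}$. The Stirling numbers of the first kind $S_1(n,k)$ are defined by $\frac{1}{k!}\log^k(1+t)=\sum_{n\ge k}S_1(n,k)\frac{t^n}{n!}$. *)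

theory Defs
  imports "HOL-Probability.Probability" "HOL-Computational_Algebra.Formal_Power_Series"
begin

definition deg_falling :: "real \<Rightarrow> real \<Rightarrow> nat \<Rightarrow> real" where
  "deg_falling lam x n = (\<Prod>i<n. x - real i * lam)"

definition deg_exp :: "real \<Rightarrow> real \<Rightarrow> real fps" where
  "deg_exp lam x = Abs_fps (\<lambda>k. deg_falling lam x k / fact k)"

text \<open>Division of formal power series over a field cancels the common power of the
  variable. Since \<open>deg_exp lam 1 - 1\<close> has subdegree \<open>1\<close>, the quotient below is the
  genuine power series \<open>t / (e(t) - 1)\<close> with constant term \<open>1\<close>.\<close>

definition deg_bernoulli :: "real \<Rightarrow> nat \<Rightarrow> nat \<Rightarrow> real \<Rightarrow> real" where
  "deg_bernoulli lam m n x =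
     fact n * fps_nth ((fps_X / (deg_exp lam 1 - 1)) ^ m * deg_exp lam x) n"

text \<open>These are the signed Stirling numbers of the first kind, as real numbers; the
  library function \<open>stirling\<close> is the unsigned version. The series \<open>fps_ln 1\<close> is
  \<open>log (1 + t)\<close>.\<close>

definition stirling1 :: "nat \<Rightarrow> nat \<Rightarrow> real" where
  "stirling1 n k = fact n * fps_nth (fps_const (1 / fact k) * fps_ln 1 ^ k) n"

end

theory Submission imports Defs begin

text \<open>Write \<open>e(t)\<close> for the degenerate exponential, \<open>A = t / (e(t) - 1)\<close> and
  \<open>L = log (1 + \<lambda> t) / (\<lambda> t)\<close>. Differentiation in \<open>x\<close> multiplies \<open>e\<^sup>x(t)\<close> by \<open>t L\<close>,
  while the shift \<open>x \<mapsto> x + 1\<close> multiplies it by \<open>e(t)\<close>; hence averaging \<open>e\<^sup>x\<^sup>+\<^sup>y(t)\<close> over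
  \<open>y \<in> [0,1]\<close> multiplies it by \<open>(e(t) - 1) / (t L) = 1 / (A L)\<close>. With \<open>l\<close> independent
  uniform variables the factor is \<open>1 / (A L)\<^sup>l\<close>. The two sides of the theorem are \<open>n!\<close> times
  the coefficients of \<open>t\<^sup>n\<close> in \<open>L\<^sup>m A\<^sup>m e\<^sup>x(t) / (A L)\<^sup>l\<close> and in
  \<open>(L A)\<^sup>m\<^sup>-\<^sup>l e\<^sup>x(t)\<close>.\<close>

text \<open>The coefficients of \<open>log (1 + \<lambda> t) / (\<lambda> t)\<close>.\<close>

definition deg_log_quot :: "real \<Rightarrow> real fps" where
  "deg_log_quot lam = Abs_fps (\<lambda>n. (- lam) ^ n / real (Suc n))"

definition deg_bernoulli_fps :: "real \<Rightarrow> real fps" where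
  "deg_bernoulli_fps lam = fps_X / (deg_exp lam 1 - 1)"

section \<open>The degenerate exponential: differential equations, addition law, derivative in
  \<open>x\<close>\<close>

lemma deg_exp_nth_0 [simp]: "fps_nth (deg_exp lam x) 0 = 1"
  by (simp add: deg_exp_def deg_falling_def)

lemma deg_exp_nth_Suc:
  "real (Suc n) * fps_nth (deg_exp lam x) (Suc n) = (x - real n * lam) * fps_nth (deg_exp lam x) n"
  by (simp add: deg_exp_def deg_falling_def mult.commute del: of_nat_Suc)

text \<open>Comparing coefficients with this formula turns a linear differential equation in
  \<open>t\<close> into a recurrence between neighbouring coefficients, and back.\<close>

lemma one_plus_mult_deriv_nth:
  "fps_nth ((1 + fps_const lam * fps_X) * fps_deriv f) n =
     real (Suc n) * fps_nth f (Suc n) + lam * real n * fps_nth f n"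
  for f :: "real fps"
  by (cases n) (simp_all add: algebra_simps)

lemma deg_exp_ode:
  "(1 + fps_const lam * fps_X) * fps_deriv (deg_exp lam x) = fps_const x * deg_exp lam x"
proof (rule fps_ext)
  fix n
  show "fps_nth ((1 + fps_const lam * fps_X) * fps_deriv (deg_exp lam x)) n
      = fps_nth (fps_const x * deg_exp lam x) n"
    unfolding one_plus_mult_deriv_nth deg_exp_nth_Suc by (simp add: algebra_simps)
qed

lemma deg_log_ode:
  "(1 + fps_const lam * fps_X) * fps_deriv (fps_X * deg_log_quot lam) = 1"
proof (rule fps_ext)
  fix n
  show "fps_nth ((1 + fps_const lam * fps_X) * fps_deriv (fps_X * deg_log_quot lam)) n
      = fps_nth 1 n"
    unfolding one_plus_mult_deriv_nth
    by (cases n) (simp_all add: deg_log_quot_def field_simps del: of_nat_Suc)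
qed

text \<open>The product rule gives the right side the differential equation of the left side. The
  resulting recurrence and the constant term 1 determine all coefficients.\<close>

lemma deg_exp_add: "deg_exp lam (x + y) = deg_exp lam x * deg_exp lam y"
proof -
  define P where "P = deg_exp lam x * deg_exp lam y"
  have "(1 + fps_const lam * fps_X) * fps_deriv P
      = ((1 + fps_const lam * fps_X) * fps_deriv (deg_exp lam x)) * deg_exp lam y
        + deg_exp lam x * ((1 + fps_const lam * fps_X) * fps_deriv (deg_exp lam y))"
    by (simp add: P_def algebra_simps)
  also have "\<dots> = fps_const (x + y) * P"
    unfolding deg_exp_ode P_def by (simp add: algebra_simps flip: fps_const_add)
  finally have ode: "(1 + fps_const lam * fps_X) * fps_deriv P = fps_const (x + y) * P" .
  have rec: "real (Suc n) * fps_nth P (Suc n) = (x + y - real n * lam) * fps_nth P n" for n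
    using arg_cong[OF ode, of "\<lambda>f. fps_nth f n"] unfolding one_plus_mult_deriv_nth
    by (simp add: algebra_simps)
  have "fps_nth (deg_exp lam (x + y)) n = fps_nth P n" for n
  proof (induction n)
    case (Suc n)
    have "real (Suc n) * fps_nth (deg_exp lam (x + y)) (Suc n) = real (Suc n) * fps_nth P (Suc n)"
      unfolding deg_exp_nth_Suc rec Suc ..
    then show ?case by simp
  qed (simp add: P_def)
  then show ?thesis unfolding P_def by (rule fps_ext)
qed

text \<open>Formally, \<open>e\<^sub>\<lambda>\<^sup>x(t) = exp (x T)\<close> with \<open>T = log (1 + \<lambda> t) / \<lambda>\<close>.\<close>

lemma has_derivative_deg_exp_nth:
  "((\<lambda>x. fps_nth (deg_exp lam x) n) has_real_derivative
     fps_nth (fps_X * deg_log_quot lam * deg_exp lam x) n) (at x)"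
proof (induction n)
  case (Suc n)
  let ?T = "fps_X * deg_log_quot lam"
  let ?H = "?T * deg_exp lam x"
  \<comment> \<open>The differential equation for \<open>?H\<close> yields for its coefficients
    exactly the recurrence that arises from \<open>deg_exp_nth_Suc\<close> by differentiating in
    \<open>x\<close>.\<close>
  have "(1 + fps_const lam * fps_X) * fps_deriv ?H
      = ((1 + fps_const lam * fps_X) * fps_deriv ?T) * deg_exp lam x
        + ?T * ((1 + fps_const lam * fps_X) * fps_deriv (deg_exp lam x))"
    unfolding fps_deriv_mult[of ?T] by (simp add: algebra_simps)
  also have "\<dots> = deg_exp lam x + fps_const x * ?H"
    unfolding deg_exp_ode deg_log_ode by (simp add: algebra_simps)
  finally have "fps_nth ((1 + fps_const lam * fps_X) * fps_deriv ?H) n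
      = fps_nth (deg_exp lam x + fps_const x * ?H) n" by (rule arg_cong)
  then have rec: "real (Suc n) * fps_nth ?H (Suc n)
      = fps_nth (deg_exp lam x) n + (x - real n * lam) * fps_nth ?H n"
    unfolding one_plus_mult_deriv_nth by (simp add: algebra_simps)
  have "((\<lambda>x. (x - real n * lam) * fps_nth (deg_exp lam x) n / real (Suc n)) has_real_derivative
      fps_nth ?H (Suc n)) (at x)"
  proof -
    have "((\<lambda>x. (x - real n * lam) * fps_nth (deg_exp lam x) n) has_real_derivative
        real (Suc n) * fps_nth ?H (Suc n)) (at x)"
      unfolding rec by (rule derivative_eq_intros Suc refl)+ simp
    from DERIV_cdivide[OF this, of "real (Suc n)"] show ?thesis
      by (simp del: of_nat_Suc)
  qed
  moreover have "fps_nth (deg_exp lam x) (Suc n)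
      = (x - real n * lam) * fps_nth (deg_exp lam x) n / real (Suc n)" for x
    using deg_exp_nth_Suc[of n lam x] by (simp add: field_simps del: of_nat_Suc)
  ultimately show ?case by simp
qed simp

text \<open>A coefficient of the product is a finite linear combination of coefficients of
  \<open>deg_exp lam x\<close> with weights free of \<open>x\<close>.\<close>

lemma has_derivative_mult_deg_exp_nth:
  "((\<lambda>x. fps_nth (F * deg_exp lam x) n) has_real_derivative
     fps_nth (F * (fps_X * deg_log_quot lam) * deg_exp lam x) n) (at x)"
  unfolding mult.assoc[of F] unfolding fps_mult_nth[of F]
  by (rule has_derivative_deg_exp_nth DERIV_sum DERIV_cmult)+

lemma isCont_mult_deg_exp_nth: "isCont (\<lambda>x. fps_nth (F * deg_exp lam x) n) x"
  using has_derivative_mult_deg_exp_nth by (rule DERIV_isCont)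

lemma continuous_on_mult_deg_exp_nth: "continuous_on S (\<lambda>x. fps_nth (F * deg_exp lam x) n)"
  by (simp add: continuous_at_imp_continuous_on isCont_mult_deg_exp_nth)

lemma measurable_mult_deg_exp_nth [measurable]:
  "(\<lambda>x. fps_nth (F * deg_exp lam x) n) \<in> borel_measurable borel"
  by (intro borel_measurable_continuous_onI continuous_on_mult_deg_exp_nth)

section \<open>Averaging over uniform variables\<close>

lemma
  shows deg_bernoulli_fps_mult: "deg_bernoulli_fps lam * (deg_exp lam 1 - 1) = fps_X"
    and deg_bernoulli_fps_nth_0: "fps_nth (deg_bernoulli_fps lam) 0 = 1"
proof -
  define U where "U = Abs_fps (\<lambda>n. fps_nth (deg_exp lam 1) (Suc n))"
  have U: "deg_exp lam 1 - 1 = fps_X * U"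
  proof (rule fps_ext)
    fix n show "fps_nth (deg_exp lam 1 - 1) n = fps_nth (fps_X * U) n"
      by (cases n) (auto simp: U_def)
  qed
  have U0: "fps_nth U 0 = 1"
    by (simp add: U_def deg_exp_def deg_falling_def)
  \<comment> \<open>The constant term 1 makes \<open>U\<close> a unit, so the division in
    \<open>deg_bernoulli_fps\<close> is exact.\<close>
  then have "fps_X * U dvd fps_X"
    by (metis dvd_refl fps_is_unit_iff mult_unit_dvd_iff zero_neq_one)
  then show mult: "deg_bernoulli_fps lam * (deg_exp lam 1 - 1) = fps_X"
    unfolding deg_bernoulli_fps_def U by (rule dvd_div_mult_self)
  then have "fps_X * (deg_bernoulli_fps lam * U) = fps_X * 1"
    unfolding U by (simp add: algebra_simps)
  then have "deg_bernoulli_fps lam * U = 1"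
    using fps_X_neq_zero mult_left_cancel by blast
  from arg_cong[OF this, of "\<lambda>f. fps_nth f 0"] U0
  show "fps_nth (deg_bernoulli_fps lam) 0 = 1" by simp
qed

text \<open>The integrand is a derivative in \<open>y\<close>, so the integral is a difference of
  endpoint values. The series \<open>G\<close> carries the factors not involved in this
  average.\<close>

lemma integral_uniform_deg_exp_nth:
  fixes lam x :: real
  defines "C \<equiv> deg_bernoulli_fps lam * deg_log_quot lam"
  shows "(\<integral>y. fps_nth (C * G * deg_exp lam (x + y)) n \<partial>uniform_measure lborel {0..1})
    = fps_nth (G * deg_exp lam x) n"
proof -
  \<comment> \<open>\<open>?F\<close> omits the logarithmic factor of \<open>C\<close> because
    differentiation supplies it together with \<open>fps_X\<close>; that \<open>fps_X\<close> is why
    the antiderivative is read off at index \<open>Suc n\<close>.\<close>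
  let ?F = "deg_bernoulli_fps lam * G"
  have shift: "?F * (fps_X * deg_log_quot lam) * deg_exp lam z = fps_X * (C * G * deg_exp lam z)" for z
    by (simp add: C_def algebra_simps)
  have "(\<integral>y. fps_nth (C * G * deg_exp lam (x + y)) n \<partial>uniform_measure lborel {0..1})
      = (\<integral>y. fps_nth (C * G * deg_exp lam (x + y)) n * indicator {0..1} y \<partial>lborel)"
  proof -
    have "uniform_measure lborel {0..1::real} = density lborel (\<lambda>y. ennreal (indicator {0..1} y))"
      by (simp add: uniform_measure_def divide_ennreal_def ennreal_indicator)
    then show ?thesis by (simp add: integral_density mult.commute)
  qed
  also have "\<dots> = fps_nth (?F * deg_exp lam (x + 1)) (Suc n) - fps_nth (?F * deg_exp lam (x + 0)) (Suc n)"
  proof (rule integral_FTC_Icc_real)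
    fix y :: real
    show "((\<lambda>y. fps_nth (?F * deg_exp lam (x + y)) (Suc n)) has_real_derivative
        fps_nth (C * G * deg_exp lam (x + y)) n) (at y)"
      using has_derivative_mult_deg_exp_nth[of ?F lam "Suc n" "y + x"]
      unfolding shift DERIV_shift by (simp add: add.commute)
    show "isCont (\<lambda>y. fps_nth (C * G * deg_exp lam (x + y)) n) y"
      by (rule isCont_o2[OF _ isCont_mult_deg_exp_nth]) simp
  qed simp
  \<comment> \<open>By the addition law the endpoints differ by the factor
    \<open>deg_exp lam 1 - 1\<close>; its product with \<open>deg_bernoulli_fps lam\<close> is
    \<open>fps_X\<close>, which lowers the index back to \<open>n\<close>.\<close>
  also have "\<dots> = fps_nth (deg_bernoulli_fps lam * (deg_exp lam 1 - 1) * (G * deg_exp lam x)) (Suc n)"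
    by (simp add: deg_exp_add algebra_simps flip: fps_sub_nth)
  also have "\<dots> = fps_nth (G * deg_exp lam x) n"
    unfolding deg_bernoulli_fps_mult by simp
  finally show ?thesis .
qed

text \<open>Continuity bounds \<open>f\<close> on the compact interval. This supplies the
  integrability that Fubini needs.\<close>

lemma (in prob_space) integrable_continuous_AE_bounded:
  fixes f :: "real \<Rightarrow> real"
  assumes [measurable]: "S \<in> borel_measurable M"
    and "continuous_on UNIV f" "AE \<omega> in M. S \<omega> \<in> {a..b}"
  shows "integrable M (\<lambda>\<omega>. f (S \<omega>))"
proof -
  have [measurable]: "f \<in> borel_measurable borel"
    using assms(2) by (rule borel_measurable_continuous_onI)
  have "compact (f ` {a..b})"
    using assms(2) by (intro compact_continuous_image) (auto intro: continuous_on_subset)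
  then obtain B where "\<And>z. z \<in> {a..b} \<Longrightarrow> norm (f z) \<le> B"
    by (metis bounded_iff compact_imp_bounded imageI)
  then show ?thesis
    using assms(3) by (intro integrable_const_bound[of _ B]) auto
qed

text \<open>Induction on \<open>l\<close>: integrating out the newest variable cancels one factor
  \<open>C\<close>, and the other factors wait inside the arbitrary series.\<close>

lemma (in prob_space) expectation_deg_exp_nth:
  fixes lam x :: real and Y :: "nat \<Rightarrow> 'a \<Rightarrow> real"
  defines "C \<equiv> deg_bernoulli_fps lam * deg_log_quot lam"
  assumes indep: "indep_vars (\<lambda>_. borel) Y {1..}"
    and unif: "\<And>i. i \<ge> 1 \<Longrightarrow> distr M borel (Y i) = uniform_measure lborel {0..1}"
  shows "expectation (\<lambda>\<omega>. fps_nth (C ^ l * G * deg_exp lam (x + (\<Sum>i=1..l. Y i \<omega>))) n)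
    = fps_nth (G * deg_exp lam x) n"
proof (induction l arbitrary: G)
  case 0
  show ?case by (simp add: prob_space)
next
  case (Suc l)
  define S where "S k \<omega> = (\<Sum>i=1..k. Y i \<omega>)" for k \<omega>
  have Y [measurable]: "Y i \<in> borel_measurable M" if "i \<ge> 1" for i
    using indep that by (auto simp: indep_vars_def)
  have S [measurable]: "S k \<in> borel_measurable M" for k
    unfolding S_def by measurable
  have "AE \<omega> in M. Y i \<omega> \<in> {0..1}" if "i \<ge> 1" for i
  proof -
    have "AE y in distr M borel (Y i). y \<in> {0..1}"
      unfolding unif[OF that] by (rule AE_uniform_measureI) auto
    then show ?thesis using Y[OF that] by (simp add: AE_distr_iff)
  qed
  then have "AE \<omega> in M. \<forall>i\<in>{1..Suc l}. Y i \<omega> \<in> {0..1}"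
    by (intro AE_finite_allI) auto
  then have S_bound: "AE \<omega> in M. S (Suc l) \<omega> \<in> {0..real (Suc l)}"
  proof eventually_elim
    case (elim \<omega>)
    then show ?case
      unfolding S_def using sum_mono[of "{1..Suc l}" "\<lambda>i. Y i \<omega>" "\<lambda>_. 1"]
      by (auto intro!: sum_nonneg simp del: sum.cl_ivl_Suc)
  qed
  \<comment> \<open>Independence makes the joint law of the newest variable and the previous partial
    sum a product measure.\<close>
  have "indep_var borel (Y (Suc l)) borel (S l)"
    unfolding S_def
    by (intro indep_vars_sum indep_vars_subset[OF indep]) auto
  then have "distr M borel (Y (Suc l)) \<Otimes>\<^sub>M distr M borel (S l)
      = distr M (borel \<Otimes>\<^sub>M borel) (\<lambda>\<omega>. (Y (Suc l) \<omega>, S l \<omega>))"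
    by (simp add: indep_var_distribution_eq)
  then have D: "uniform_measure lborel {0..1} \<Otimes>\<^sub>M distr M borel (S l)
      = distr M (borel \<Otimes>\<^sub>M borel) (\<lambda>\<omega>. (Y (Suc l) \<omega>, S l \<omega>))"
    by (simp add: unif)
  interpret U: prob_space "uniform_measure lborel {0..1::real}"
    by (rule prob_space_uniform_measure) auto
  interpret DS: prob_space "distr M borel (S l)"
    by (rule prob_space_distr) measurable
  interpret P: pair_prob_space "uniform_measure lborel {0..1::real}" "distr M borel (S l)" ..
  define f where "f y s = fps_nth (C * (C ^ l * G) * deg_exp lam (x + s + y)) n" for y s
  have f_meas [measurable]: "case_prod f \<in> borel_measurable (borel \<Otimes>\<^sub>M borel)"
    unfolding f_def by measurable
  have S_Suc: "x + S l \<omega> + Y (Suc l) \<omega> = x + S (Suc l) \<omega>" for \<omega>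
    by (simp add: S_def)
  have "continuous_on UNIV (\<lambda>s. fps_nth (C * (C ^ l * G) * deg_exp lam (x + s)) n)"
    by (rule continuous_on_compose2[OF continuous_on_mult_deg_exp_nth]) (auto intro!: continuous_intros)
  then have "integrable M (\<lambda>\<omega>. fps_nth (C * (C ^ l * G) * deg_exp lam (x + S (Suc l) \<omega>)) n)"
    using S_bound by (intro integrable_continuous_AE_bounded[OF S])
  then have int: "integrable (uniform_measure lborel {0..1} \<Otimes>\<^sub>M distr M borel (S l)) (case_prod f)"
    unfolding D by (subst integrable_distr_eq) (auto simp: f_def S_Suc)
  have "expectation (\<lambda>\<omega>. fps_nth (C ^ Suc l * G * deg_exp lam (x + S (Suc l) \<omega>)) n)
      = expectation (\<lambda>\<omega>. f (Y (Suc l) \<omega>) (S l \<omega>))"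
    by (simp add: f_def S_Suc mult.assoc)
  also have "\<dots> = (\<integral>p. case_prod f p \<partial>(uniform_measure lborel {0..1} \<Otimes>\<^sub>M distr M borel (S l)))"
    unfolding D by (subst integral_distr) auto
  \<comment> \<open>Fubini, with the uniform variable inside, so that the one-variable average
    applies at base point \<open>x + s\<close>.\<close>
  also have "\<dots> = (\<integral>s. (\<integral>y. f y s \<partial>uniform_measure lborel {0..1}) \<partial>distr M borel (S l))"
    using P.integral_snd[OF int] by simp
  also have "\<dots> = (\<integral>s. fps_nth (C ^ l * G * deg_exp lam (x + s)) n \<partial>distr M borel (S l))"
    unfolding f_def C_def integral_uniform_deg_exp_nth ..
  also have "\<dots> = expectation (\<lambda>\<omega>. fps_nth (C ^ l * G * deg_exp lam (x + S l \<omega>)) n)"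
    by (subst integral_distr) auto
  also have "\<dots> = fps_nth (G * deg_exp lam x) n"
    unfolding S_def by (rule Suc.IH)
  finally show ?case unfolding S_def .
qed

section \<open>Stirling numbers as coefficients, and the final comparison\<close>

text \<open>Substituting \<open>lam * t\<close> for \<open>t\<close> reduces to
  \<open>lam = 1\<close> and produces \<open>lam ^ j\<close>. There \<open>fps_ln 1\<close> is
  \<open>fps_X\<close> times the series, so its \<open>m\<close>-th power has the same coefficients
  shifted by \<open>m\<close>.\<close>

lemma deg_log_quot_power_nth:
  "fps_nth (deg_log_quot lam ^ m) j = lam ^ j * stirling1 (j + m) m / (real ((j + m) choose m) * fact j)"
proof -
  have "deg_log_quot lam = deg_log_quot 1 oo (fps_const lam * fps_X)"
    by (simp add: fps_eq_iff deg_log_quot_def fps_compose_linear flip: power_mult_distrib)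
  then have "deg_log_quot lam ^ m = deg_log_quot 1 ^ m oo (fps_const lam * fps_X)"
    by (simp add: fps_compose_power)
  then have scale: "fps_nth (deg_log_quot lam ^ m) j = lam ^ j * fps_nth (deg_log_quot 1 ^ m) j"
    by (simp add: fps_compose_linear)
  have "fps_ln 1 = fps_X * deg_log_quot 1"
    by (rule fps_ext) (auto simp: fps_ln_nth deg_log_quot_def)
  then have "fps_nth (fps_ln 1 ^ m) (j + m) = fps_nth (deg_log_quot 1 ^ m) j"
    by (simp add: power_mult_distrib fps_X_power_mult_nth)
  then have "stirling1 (j + m) m = fact (j + m) / fact m * fps_nth (deg_log_quot 1 ^ m) j"
    by (simp add: stirling1_def)
  moreover have "real ((j + m) choose m) = fact (j + m) / (fact m * fact j)"
    by (simp add: binomial_fact)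
  ultimately show ?thesis
    by (simp add: scale)
qed

text \<open>Both sides of the theorem are such sums: up to factorials, the weights are coefficients
  of \<open>deg_log_quot lam ^ m\<close>, and the sum is a Cauchy product.\<close>

lemma deg_bernoulli_convolution:
  assumes "\<And>k. k \<le> n \<Longrightarrow> b k = fact k * fps_nth F k"
  shows "(\<Sum>k=0..n. real (n choose k) / real ((n - k + m) choose m) * lam ^ (n - k)
      * stirling1 (n - k + m) m * b k) = fact n * fps_nth (F * deg_log_quot lam ^ m) n"
  unfolding fps_mult_nth sum_distrib_left
proof (rule sum.cong)
  fix k assume k: "k \<in> {0..n}"
  then have "real (n choose k) = fact n / (fact k * fact (n - k))"
    by (simp add: binomial_fact)
  moreover have "real ((n - k + m) choose m) \<noteq> 0" by simp
  ultimately show "real (n choose k) / real ((n - k + m) choose m) * lam ^ (n - k)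
      * stirling1 (n - k + m) m * b k
      = fact n * (fps_nth F k * fps_nth (deg_log_quot lam ^ m) (n - k))"
    using k by (simp add: assms deg_log_quot_power_nth field_simps)
qed simp

theorem theorem3p6:
  fixes M :: "'a measure" and Y :: "nat \<Rightarrow> 'a \<Rightarrow> real"
    and lam x :: real and m l n :: nat
  assumes "prob_space M"
    and "prob_space.indep_vars M (\<lambda>_. borel) Y {1..}"
    and "\<And>i. i \<ge> 1 \<Longrightarrow> distr M borel (Y i) = uniform_measure lborel {0..1}"
    and "lam \<noteq> 0"
    and "l \<le> m"
  shows "(\<Sum>k=0..n. real (n choose k) / real ((n - k + m) choose m) * lam ^ (n - k)
            * stirling1 (n - k + m) m
            * prob_space.expectation M (\<lambda>\<omega>. deg_bernoulli lam m k (x + (\<Sum>i=1..l. Y i \<omega>))))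
       = (\<Sum>k=0..n. real (n choose k) / real ((n - k + (m - l)) choose (m - l)) * lam ^ (n - k)
            * stirling1 (n - k + (m - l)) (m - l)
            * deg_bernoulli lam (m - l) k x)"
proof -
  interpret prob_space M by fact
  let ?A = "deg_bernoulli_fps lam" and ?L = "deg_log_quot lam"
  \<comment> \<open>\<open>?L\<close> has constant term 1 and is therefore invertible.\<close>
  have L: "?L ^ l * inverse ?L ^ l = 1"
    by (simp add: deg_log_quot_def inverse_mult_eq_1' flip: power_mult_distrib)
  let ?F = "inverse ?L ^ l * ?A ^ (m - l) * deg_exp lam x"
  have pow: "f ^ m = f ^ l * f ^ (m - l)" for f :: "real fps"
    using \<open>l \<le> m\<close> by (simp flip: power_add)
  \<comment> \<open>This exposes the factor \<open>(?A * ?L) ^ l\<close> that the expectation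
    removes; what remains, times \<open>deg_exp lam x\<close>, is \<open>?F\<close>.\<close>
  have A: "?A ^ m = (?A * ?L) ^ l * (inverse ?L ^ l * ?A ^ (m - l))"
  proof -
    have "(?A * ?L) ^ l * (inverse ?L ^ l * ?A ^ (m - l))
        = ?A ^ l * ?A ^ (m - l) * (?L ^ l * inverse ?L ^ l)"
      by (simp add: power_mult_distrib algebra_simps)
    then show ?thesis unfolding L by (metis mult_1_right pow)
  qed
  have "expectation (\<lambda>\<omega>. deg_bernoulli lam m k (x + (\<Sum>i=1..l. Y i \<omega>))) = fact k * fps_nth ?F k" for k
    unfolding deg_bernoulli_def deg_bernoulli_fps_def[symmetric] A integral_mult_right_zero
    by (subst expectation_deg_exp_nth[OF assms(2,3)]) simp_all
  then have "(\<Sum>k=0..n. real (n choose k) / real ((n - k + m) choose m) * lam ^ (n - k)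
      * stirling1 (n - k + m) m
      * expectation (\<lambda>\<omega>. deg_bernoulli lam m k (x + (\<Sum>i=1..l. Y i \<omega>))))
      = fact n * fps_nth (?F * ?L ^ m) n"
    by (rule deg_bernoulli_convolution)
  \<comment> \<open>Of the \<open>m\<close> factors \<open>?L\<close>, \<open>l\<close> cancel the
    inverses, leaving the series of the right-hand side.\<close>
  also have "?F * ?L ^ m = ?A ^ (m - l) * deg_exp lam x * ?L ^ (m - l) * (?L ^ l * inverse ?L ^ l)"
    unfolding pow[of ?L] by (simp add: algebra_simps)
  also have "fact n * fps_nth \<dots> n = (\<Sum>k=0..n. real (n choose k)
      / real ((n - k + (m - l)) choose (m - l)) * lam ^ (n - k)
      * stirling1 (n - k + (m - l)) (m - l) * deg_bernoulli lam (m - l) k x)"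
    unfolding L mult_1_right
    by (rule deg_bernoulli_convolution[symmetric]) (simp add: deg_bernoulli_def deg_bernoulli_fps_def)
  finally show ?thesis .
qed

end
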